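(* Consider the bilinear system on $\mathrm{SO}(n)$ $$\dot X(t)=AX(t)+\Big(\sum_{k=1}^m u_k(t)B_{i_kj_k}\Big)X(t),\qquad X(0)=I_n,$$ with $A\in\mathfrak{so}(n)$ and $B_{i_kj_k}\in\{B_{ij}:1\le i<j\le n\}$ for $k=1,\dots,m$. Suppose $A=0$. Then the system is controllable on the Lie group $\mathrm{SO}(n)$ if and only if the controlled interaction graph $\mathrm{G}_{\rm contr}$ is connected.
   Context: $\mathrm{SO}(n)$ is the group of real orthogonal $n\times n$ matrices of determinant one, and $\mathfrak{so}(n)$ is its Lie algebra of real skew-symmetric $n\times n$ matrices. $E_{ij}\in\mathbb{R}^{n\times n}$ has $(i,j)$-entry $1$ and all other entries $0$, and $B_{ij}=E_{ij}-E_{ji}$. The controls $u_k(t)\in\mathbb{R}$ are piecewise constant signals. For $T\ge 0$, $\mathcal{R}_T(I_n)$ is the set of all terminal points $X(T)$ of solutions of the system with $X(0)=I_n$ (over all admissible controls), and $\mathcal{R}(I_n)=\bigcup_{T\ge 0}\mathcal{R}_T(I_n)$. The system is controllable on $\mathrm{SO}(n)$ if $\mathcal{R}(I_n)=\mathrm{SO}(n)$. Let $\mathrm{V}=\{1,\dots,n\}$. The controlled interaction graph is the undirected graph $\mathrm{G}_{\rm contr}=(\mathrm{V},\mathrm{E}_{\rm contr})$ with $\mathrm{E}_{\rm contr}=\{\{i_1,j_1\},\dots,\{i_m,j_m\}\}$. A graph is connected if every two distinct nodes are joined by a path. *)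

theory Defs
  imports "HOL-Analysis.Analysis"
begin

definition SO :: "(real^'n^'n) set" where
  "SO = {X. rotation_matrix X}"

definition so :: "(real^'n^'n) set" where
  "so = {A. transpose A = - A}"

definition Emat :: "'n \<Rightarrow> 'n \<Rightarrow> real^'n^'n" where
  "Emat i j = (\<chi> r c. if r = i \<and> c = j then 1 else 0)"

definition Bmat :: "'n \<Rightarrow> 'n \<Rightarrow> real^'n^'n" where
  "Bmat i j = Emat i j - Emat j i"

text \<open>
  A signal on the half-line of nonnegative times is piecewise constant if its switching times do
  not accumulate and it is constant on every interval free of them; its values at the switching
  times themselves are arbitrary.
\<close>

definition piecewise_constant :: "(real \<Rightarrow> real) \<Rightarrow> bool" where
  "piecewise_constant u \<longleftrightarrow>
    (\<exists>S. (\<forall>T. finite (S \<inter> {0..T})) \<and>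
         (\<forall>a b. 0 \<le> a \<and> {a..b} \<inter> S = {} \<longrightarrow> u constant_on {a..b}))"

text \<open>
  A trajectory of a system with discontinuous controls is continuous, but it satisfies the
  differential equation only away from finitely many times (the switching times).
\<close>

definition bilinear_solution ::
  "real^'n^'n \<Rightarrow> nat \<Rightarrow> (nat \<Rightarrow> real^'n^'n) \<Rightarrow> (nat \<Rightarrow> real \<Rightarrow> real) \<Rightarrow> real \<Rightarrow>
    (real \<Rightarrow> real^'n^'n) \<Rightarrow> bool" where
  "bilinear_solution A m B u T X \<longleftrightarrow>
    continuous_on {0..T} X \<and>
    (\<exists>S. finite S \<and>
      (\<forall>t\<in>{0..T} - S.
        (X has_vector_derivative (A ** X t + (\<Sum>k = 1..m. u k t *\<^sub>R B k) ** X t))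
          (at t within {0..T})))"

definition reach_at ::
  "real^'n^'n \<Rightarrow> nat \<Rightarrow> (nat \<Rightarrow> real^'n^'n) \<Rightarrow> real^'n^'n \<Rightarrow> real \<Rightarrow> (real^'n^'n) set" where
  "reach_at A m B X0 T =
    {X T | X u. (\<forall>k\<in>{1..m}. piecewise_constant (u k)) \<and>
                bilinear_solution A m B u T X \<and> X 0 = X0}"

definition reach ::
  "real^'n^'n \<Rightarrow> nat \<Rightarrow> (nat \<Rightarrow> real^'n^'n) \<Rightarrow> real^'n^'n \<Rightarrow> (real^'n^'n) set" where
  "reach A m B X0 = (\<Union>T\<in>{0..}. reach_at A m B X0 T)"

definition controllable_on_SO ::
  "real^'n^'n \<Rightarrow> nat \<Rightarrow> (nat \<Rightarrow> real^'n^'n) \<Rightarrow> bool" where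
  "controllable_on_SO A m B \<longleftrightarrow> reach A m B (mat 1) = SO"

text \<open>An undirected graph is given by its node set and a set of two-element edges.\<close>

definition graph_path :: "'v set \<Rightarrow> 'v set set \<Rightarrow> 'v \<Rightarrow> 'v list \<Rightarrow> 'v \<Rightarrow> bool" where
  "graph_path V E x p y \<longleftrightarrow>
    p \<noteq> [] \<and> hd p = x \<and> last p = y \<and> set p \<subseteq> V \<and> distinct p \<and>
    successively (\<lambda>v w. {v, w} \<in> E) p"

definition graph_connected :: "'v set \<Rightarrow> 'v set set \<Rightarrow> bool" where
  "graph_connected V E \<longleftrightarrow> (\<forall>x\<in>V. \<forall>y\<in>V. x \<noteq> y \<longrightarrow> (\<exists>p. graph_path V E x p y))"

definition controlled_edges :: "nat \<Rightarrow> (nat \<Rightarrow> 'v) \<Rightarrow> (nat \<Rightarrow> 'v) \<Rightarrow> 'v set set" where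
  "controlled_edges m i j = (\<lambda>k. {i k, j k}) ` {1..m}"

end

theory Submission
  imports Defs
begin

text \<open>
  Trajectories of a system with skew-symmetric coefficients stay in the rotation group: along them
  \<open>X\<^sup>T X\<close> is constant and the determinant cannot jump (\<open>skew_flow_SO\<close>). Controllability of the
  driftless system therefore means that every rotation is reached.

  Suppose the graph is connected. Activating a single control for one unit of time multiplies the
  current point from the left by an arbitrary rotation of the coordinate plane of the corresponding
  edge (\<open>reach_step\<close>). Conjugating a rotation of the \<open>(i, j)\<close>-plane by a quarter turn of the
  \<open>(j, k)\<close>-plane gives a rotation of the \<open>(i, k)\<close>-plane (\<open>plane_rotation_conjugate\<close>), so following
  paths in the graph makes the rotations of all coordinate planes available. These generate the
  whole group by Givens elimination (\<open>rotation_monoid.SO_subset\<close>). This replaces the Lie algebra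
  rank condition: all exponentials that occur have a closed form, and no Lie theory is needed.

  Suppose the graph is not connected. The orthogonal projection \<open>M\<close> onto the coordinates of one
  component commutes with every control matrix, hence \<open>X\<^sup>T M X\<close> is constant along trajectories
  (\<open>skew_flow_conserves\<close>). So reachable matrices commute with \<open>M\<close>, whereas a quarter turn mixing
  two components does not.
\<close>

section \<open>Linearity of the matrix operations\<close>
lemma bounded_bilinear_matrix_mult:
  "bounded_bilinear ((**) :: real^'n^'m \<Rightarrow> real^'k^'n \<Rightarrow> real^'k^'m)"
  unfolding bilinear_conv_bounded_bilinear[symmetric] bilinear_def
  by (auto intro!: linearI simp: matrix_matrix_mult_def vec_eq_iff sum.distrib
      sum_distrib_left algebra_simps)

lemmas matrix_mult_linear_simps =
  bounded_bilinear.add_left[OF bounded_bilinear_matrix_mult]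
  bounded_bilinear.add_right[OF bounded_bilinear_matrix_mult]
  bounded_bilinear.diff_left[OF bounded_bilinear_matrix_mult]
  bounded_bilinear.diff_right[OF bounded_bilinear_matrix_mult]
  bounded_bilinear.minus_left[OF bounded_bilinear_matrix_mult]
  bounded_bilinear.minus_right[OF bounded_bilinear_matrix_mult]
  bounded_bilinear.scaleR_left[OF bounded_bilinear_matrix_mult]
  bounded_bilinear.scaleR_right[OF bounded_bilinear_matrix_mult]
  bounded_bilinear.sum_left[OF bounded_bilinear_matrix_mult]
  bounded_bilinear.sum_right[OF bounded_bilinear_matrix_mult]
  bounded_bilinear.zero_left[OF bounded_bilinear_matrix_mult]
  bounded_bilinear.zero_right[OF bounded_bilinear_matrix_mult]

lemma bounded_linear_transpose: "bounded_linear (transpose :: real^'n^'m \<Rightarrow> real^'m^'n)"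
  unfolding linear_conv_bounded_linear[symmetric]
  by (auto intro!: linearI simp: transpose_def vec_eq_iff)

lemmas transpose_linear_simps =
  linear_0[OF bounded_linear.linear[OF bounded_linear_transpose]]
  linear_add[OF bounded_linear.linear[OF bounded_linear_transpose]]
  linear_diff[OF bounded_linear.linear[OF bounded_linear_transpose]]
  linear_neg[OF bounded_linear.linear[OF bounded_linear_transpose]]
  linear_cmul[OF bounded_linear.linear[OF bounded_linear_transpose]]
  linear_sum[OF bounded_linear.linear[OF bounded_linear_transpose]]

lemma continuous_on_det:
  fixes X :: "'a::topological_space \<Rightarrow> real^'n^'n"
  assumes "continuous_on S X"
  shows "continuous_on S (\<lambda>t. det (X t))"
  unfolding det_def by (intro continuous_intros assms)

section \<open>Flows with skew-symmetric generator\<close>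

text \<open>
  Conservation law behind both directions. By the product rule the derivative of
  \<open>X\<^sup>T M X\<close> is \<open>X\<^sup>T (W\<^sup>T M + M W) X = X\<^sup>T (M W - W M) X\<close>, which vanishes because
  \<open>M\<close> commutes with \<open>W\<close>. Taking \<open>M = I\<close> gives orthogonality of the flow; taking \<open>M\<close> to be a
  coordinate projection detects the connected components of the interaction graph. The finite
  exceptional set \<open>S\<close> accommodates the switching times of a control.
\<close>
lemma skew_flow_conserves:
  fixes X W :: "real \<Rightarrow> real^'n^'n"
  assumes cont: "continuous_on {0..T} X" and "finite S"
    and deriv: "\<And>t. t \<in> {0..T} - S \<Longrightarrow>
      (X has_vector_derivative (W t ** X t)) (at t within {0..T})"
    and skew: "\<And>t. transpose (W t) = - W t"
    and comm: "\<And>t. M ** W t = W t ** M"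
    and t: "t \<in> {0..T}"
  shows "transpose (X t) ** M ** X t = transpose (X 0) ** M ** X 0"
proof (rule has_derivative_zero_unique_strong_interval[OF \<open>finite S\<close> _ refl _ t])
  show "continuous_on {0..T} (\<lambda>t. transpose (X t) ** M ** X t)"
    by (intro bounded_bilinear.continuous_on[OF bounded_bilinear_matrix_mult]
        bounded_linear.continuous_on[OF bounded_linear_transpose] cont continuous_on_const)
next
  fix s assume s: "s \<in> {0..T} - S"
  have 1: "((\<lambda>t. transpose (X t)) has_vector_derivative transpose (W s ** X s)) (at s within {0..T})"
    by (rule bounded_linear.has_vector_derivative[OF bounded_linear_transpose deriv[OF s]])
  have 2: "((\<lambda>t. M ** X t) has_vector_derivative M ** (W s ** X s)) (at s within {0..T})"
    by (rule bounded_linear.has_vector_derivative[OF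
          bounded_bilinear.bounded_linear_right[OF bounded_bilinear_matrix_mult] deriv[OF s]])
  have "((\<lambda>t. transpose (X t) ** (M ** X t)) has_vector_derivative
      transpose (X s) ** (M ** (W s ** X s)) + transpose (W s ** X s) ** (M ** X s))
      (at s within {0..T})"
    by (rule bounded_bilinear.has_vector_derivative[OF bounded_bilinear_matrix_mult 1 2])
  moreover have "transpose (W s ** X s) ** (M ** X s) = - (transpose (X s) ** (W s ** M) ** X s)"
    by (simp add: matrix_transpose_mul skew matrix_mult_linear_simps matrix_mul_assoc)
  then have "transpose (X s) ** (M ** (W s ** X s)) + transpose (W s ** X s) ** (M ** X s) = 0"
    by (simp add: comm[symmetric] matrix_mul_assoc)
  ultimately show "((\<lambda>t. transpose (X t) ** M ** X t) has_derivative (\<lambda>h. 0)) (at s within {0..T})"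
    by (simp add: has_vector_derivative_def matrix_mul_assoc)
qed

text \<open>
  Orthogonality leaves only the two determinants \<open>1\<close> and \<open>-1\<close>. A continuous path starting at
  the identity cannot pass from one to the other without meeting a singular matrix.
\<close>
lemma skew_flow_SO:
  fixes X W :: "real \<Rightarrow> real^'n^'n"
  assumes cont: "continuous_on {0..T} X" and "finite S"
    and deriv: "\<And>t. t \<in> {0..T} - S \<Longrightarrow>
      (X has_vector_derivative (W t ** X t)) (at t within {0..T})"
    and skew: "\<And>t. transpose (W t) = - W t"
    and X0: "X 0 = mat 1" and "0 \<le> T"
  shows "X T \<in> SO"
proof -
  have orth: "orthogonal_matrix (X t)" if "t \<in> {0..T}" for t
    using skew_flow_conserves[OF cont \<open>finite S\<close> deriv skew _ that, of "mat 1"]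
    by (simp add: X0 orthogonal_matrix)
  have "det (X T) \<noteq> -1"
  proof
    assume *: "det (X T) = -1"
    have "\<exists>t\<ge>0. t \<le> T \<and> det (X t) = 0"
      by (rule IVT2') (use * \<open>0 \<le> T\<close> X0 in \<open>auto intro: continuous_on_det cont\<close>)
    then show False
      using orth det_orthogonal_matrix by force
  qed
  then have "det (X T) = 1"
    using det_orthogonal_matrix[OF orth[of T]] \<open>0 \<le> T\<close> by auto
  then show ?thesis
    using orth[of T] \<open>0 \<le> T\<close> by (simp add: SO_def rotation_matrix_def)
qed

section \<open>The group of rotation matrices\<close>
lemma SO_mult: "X \<in> SO \<Longrightarrow> Y \<in> SO \<Longrightarrow> X ** Y \<in> SO"
  by (simp add: SO_def rotation_matrix_def orthogonal_matrix_mul det_mul)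

lemma SO_transpose: "X \<in> SO \<Longrightarrow> transpose X \<in> SO"
  by (simp add: SO_def rotation_matrix_def orthogonal_matrix_transpose)

lemma SO_one: "mat 1 \<in> SO"
  by (simp add: SO_def rotation_matrix_def orthogonal_matrix_id)

lemma SO_inverse:
  assumes "X \<in> SO"
  shows "transpose X ** X = mat 1" "X ** transpose X = mat 1"
  using assms by (auto simp: SO_def rotation_matrix_def orthogonal_matrix_def)

lemma SO_norm:
  assumes "X \<in> SO"
  shows "norm (X *v v) = norm v"
proof -
  have "orthogonal_transformation ((*v) X)"
    using assms by (simp add: orthogonal_transformation_matrix SO_def rotation_matrix_def)
  then show ?thesis by (rule orthogonal_transformation_norm)
qed

section \<open>Exponentials of elementary skew-symmetric matrices\<close>

text \<open>
  Rodrigues' closed form of \<open>exp (t B)\<close>, valid when \<open>B\<^sup>3 = -B\<close>: the power series then collapses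
  to a combination of \<open>I\<close>, \<open>B\<close> and \<open>B\<^sup>2\<close>. Starting from this formula avoids the matrix
  exponential altogether.
\<close>
definition rodrigues :: "real^'n^'n \<Rightarrow> real \<Rightarrow> real^'n^'n" where
  "rodrigues B t = mat 1 + sin t *\<^sub>R B + (1 - cos t) *\<^sub>R (B ** B)"

lemma rodrigues_0: "rodrigues B 0 = mat 1"
  by (simp add: rodrigues_def)

lemma rodrigues_minus: "rodrigues (- B) t = rodrigues B (- t)"
  by (simp add: rodrigues_def matrix_mult_linear_simps)

lemma transpose_rodrigues:
  "transpose B = - B \<Longrightarrow> transpose (rodrigues B t) = rodrigues B (- t)"
  by (simp add: rodrigues_def transpose_linear_simps matrix_transpose_mul matrix_mult_linear_simps)

text \<open>
  The time shift \<open>a\<close> and the rate \<open>s\<close> are there so that the formula describes the motion under the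
  constant control value \<open>s\<close> switched on at time \<open>a\<close>.
\<close>
lemma rodrigues_derivative:
  assumes "B ** B ** B = - B"
  shows "((\<lambda>t. rodrigues B ((t - a) * s)) has_vector_derivative
      (s *\<^sub>R B) ** rodrigues B ((t - a) * s)) (at t within A)"
proof -
  have "(s *\<^sub>R B) ** rodrigues B ((t - a) * s)
      = (cos ((t - a) * s) * s) *\<^sub>R B + (sin ((t - a) * s) * s) *\<^sub>R (B ** B)"
    by (simp add: rodrigues_def matrix_mult_linear_simps matrix_mul_assoc assms)
       (simp add: vec_eq_iff algebra_simps)
  then show ?thesis
    unfolding rodrigues_def
    by (auto intro!: derivative_eq_intros)
qed

text \<open>
  The curve \<open>\<tau> \<mapsto> exp (\<tau> t B)\<close> is itself a skew-symmetric flow, so no determinant has to be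
  computed.
\<close>
lemma rodrigues_SO:
  assumes "B ** B ** B = - B" "transpose B = - B"
  shows "rodrigues B t \<in> SO"
proof -
  let ?X = "\<lambda>\<tau>. rodrigues B ((\<tau> - 0) * t)"
  have deriv: "(?X has_vector_derivative (t *\<^sub>R B) ** ?X \<tau>) (at \<tau> within {0..1})" for \<tau>
    by (rule rodrigues_derivative[OF assms(1)])
  have "?X 1 \<in> SO"
  proof (rule skew_flow_SO[where X = ?X and S = "{}" and W = "\<lambda>_. t *\<^sub>R B"])
    show "continuous_on {0..1} ?X"
      by (rule continuous_on_vector_derivative) (rule deriv)
  qed (use deriv assms(2) in \<open>auto simp: transpose_linear_simps rodrigues_0\<close>)
  then show ?thesis by simp
qed

lemma rodrigues_conjugate:
  assumes "Q \<in> SO"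
  shows "Q ** rodrigues B t ** transpose Q = rodrigues (Q ** B ** transpose Q) t"
proof -
  have "Q ** B ** transpose Q ** (Q ** B ** transpose Q) = Q ** B ** (transpose Q ** Q) ** B ** transpose Q"
    by (simp only: matrix_mul_assoc)
  then have "Q ** B ** transpose Q ** (Q ** B ** transpose Q) = Q ** (B ** B) ** transpose Q"
    by (simp add: SO_inverse[OF assms] matrix_mul_assoc)
  then show ?thesis
    by (simp add: rodrigues_def matrix_mult_linear_simps SO_inverse[OF assms])
qed

lemma transpose_Bmat: "transpose (Bmat i j) = - Bmat i j"
  by (simp add: transpose_def Bmat_def Emat_def vec_eq_iff conj_commute)

lemma Bmat_swap: "Bmat j i = - Bmat i j"
  by (simp add: Bmat_def)

lemma mult_indicator:
  "(if P then 1 else 0) * y = (if P then y else (0::real))"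
  "y * (if P then 1 else 0) = (if P then y else (0::real))"
  by auto

lemma mult_Emat: "(Q ** Emat i j) $ r $ c = (if c = j then Q$r$i else 0)"
  by (cases "c = j") (simp_all add: matrix_matrix_mult_def Emat_def mult_indicator)

lemma mult_Emat_mult: "(Q ** Emat i j ** P) $ r $ c = Q$r$i * P$j$c"
proof -
  have "(Q ** Emat i j) $ r $ k * P$k$c = (if k = j then Q$r$i * P$k$c else 0)" for k
    by (simp add: mult_Emat)
  then show ?thesis
    by (simp add: matrix_matrix_mult_def[of "Q ** Emat i j"])
qed

lemma Emat_mult_vec: "Emat i j *v x = x$j *\<^sub>R axis i 1"
  by (auto simp: matrix_vector_mult_def vec_eq_iff axis_def Emat_def mult_indicator)

lemma Bmat_mult_vec: "Bmat i j *v (x::real^'n) = x$j *\<^sub>R axis i 1 - x$i *\<^sub>R axis j 1"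
  by (simp add: Bmat_def Emat_mult_vec matrix_vector_mult_diff_rdistrib)

lemma Bmat_cube:
  assumes "i \<noteq> j"
  shows "Bmat i j ** Bmat i j ** Bmat i j = - (Bmat i j :: real^'n^'n)"
  unfolding matrix_eq
proof
  fix x :: "real^'n"
  have "(Bmat i j ** Bmat i j ** Bmat i j) *v x = Bmat i j *v (Bmat i j *v (Bmat i j *v x))"
    by (simp only: matrix_vector_mul_assoc matrix_mul_assoc)
  also have "\<dots> = - (Bmat i j *v x)"
    unfolding Bmat_mult_vec using assms by (auto simp: vec_eq_iff axis_def)
  also have "\<dots> = (- Bmat i j) *v x"
    by (simp add: matrix_vector_mult_def vec_eq_iff sum_negf)
  finally show "(Bmat i j ** Bmat i j ** Bmat i j) *v x = (- Bmat i j) *v x" .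
qed

text \<open>
  \<open>B\<^sub>i\<^sub>j = e\<^sub>i e\<^sub>j\<^sup>T - e\<^sub>j e\<^sub>i\<^sup>T\<close>, so conjugation by \<open>Q\<close> replaces \<open>e\<^sub>i\<close> and \<open>e\<^sub>j\<close> by the
  corresponding columns of \<open>Q\<close>.
\<close>
lemma conjugate_Bmat:
  "(Q ** Bmat i j ** transpose Q) $ r $ c = Q$r$i * Q$c$j - Q$r$j * Q$c$i"
  unfolding Bmat_def by (simp only: matrix_mult_linear_simps vector_minus_component mult_Emat_mult)
    (simp add: transpose_def)

section \<open>Rotations in coordinate planes\<close>
definition plane_rotation :: "'n \<Rightarrow> 'n \<Rightarrow> real \<Rightarrow> real^'n^'n" where
  "plane_rotation i j t = rodrigues (Bmat i j) t"

lemma plane_rotation_SO: "i \<noteq> j \<Longrightarrow> plane_rotation i j t \<in> SO"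
  by (simp add: plane_rotation_def rodrigues_SO Bmat_cube transpose_Bmat)

lemma plane_rotation_swap: "plane_rotation j i t = plane_rotation i j (- t)"
  by (simp add: plane_rotation_def Bmat_swap[of j i] rodrigues_minus)

lemma transpose_plane_rotation: "transpose (plane_rotation i j t) = plane_rotation i j (- t)"
  by (simp add: plane_rotation_def transpose_rodrigues transpose_Bmat)

lemma plane_rotation_mult_vec:
  fixes x :: "real^'n"
  assumes "i \<noteq> j"
  shows "plane_rotation i j t *v x =
    (\<chi> k. if k = i then cos t * x$i + sin t * x$j
         else if k = j then cos t * x$j - sin t * x$i else x$k)"
proof -
  have "plane_rotation i j t *v x = x + sin t *\<^sub>R (Bmat i j *v x)
      + (1 - cos t) *\<^sub>R (Bmat i j *v (Bmat i j *v x))"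
    by (simp add: plane_rotation_def rodrigues_def matrix_vector_mult_add_rdistrib
        scaleR_matrix_vector_assoc[symmetric] matrix_vector_mul_assoc)
  also have "\<dots> = (\<chi> k. if k = i then cos t * x$i + sin t * x$j
         else if k = j then cos t * x$j - sin t * x$i else x$k)"
    unfolding Bmat_mult_vec using assms by (auto simp: vec_eq_iff axis_def algebra_simps)
  finally show ?thesis .
qed

lemma plane_rotation_fixes_axis:
  "i \<noteq> j \<Longrightarrow> k \<noteq> i \<Longrightarrow> k \<noteq> j \<Longrightarrow> plane_rotation i j t *v axis k 1 = axis k 1"
  by (simp add: plane_rotation_mult_vec vec_eq_iff axis_def)

text \<open>
  A quarter turn in the plane of \<open>e\<^sub>j\<close> and \<open>e\<^sub>k\<close> carries \<open>e\<^sub>j\<close> to \<open>e\<^sub>k\<close> and fixes \<open>e\<^sub>i\<close>, so conjugating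
  with it turns rotations of the \<open>(i, j)\<close>-plane into rotations of the \<open>(i, k)\<close>-plane. On the group
  level this is the bracket relation \<open>[B\<^sub>i\<^sub>j, B\<^sub>j\<^sub>k] = B\<^sub>i\<^sub>k\<close>; it makes being joined by available
  rotations a transitive relation on the coordinates.
\<close>
lemma plane_rotation_conjugate:
  assumes "i \<noteq> j" "j \<noteq> k" "i \<noteq> k"
  shows "plane_rotation j k (- (pi/2)) ** plane_rotation i j t ** plane_rotation j k (pi/2)
    = plane_rotation i k t"
proof -
  let ?Q = "plane_rotation j k (- (pi/2))"
  have entry: "?Q $ r $ c = (?Q *v axis c 1) $ r" for r c
    by (simp add: matrix_vector_mult_basis column_def)
  have "?Q ** Bmat i j ** transpose ?Q = Bmat i k"
    unfolding vec_eq_iff conjugate_Bmat entry plane_rotation_mult_vec[OF assms(2)]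
    using assms by (auto simp: axis_def Bmat_def Emat_def)
  moreover have "transpose ?Q = plane_rotation j k (pi/2)"
    by (simp add: transpose_plane_rotation)
  ultimately show ?thesis
    using rodrigues_conjugate[OF plane_rotation_SO[OF assms(2)], of "- (pi/2)" "Bmat i j" t]
    by (simp add: plane_rotation_def)
qed

section \<open>Plane rotations generate the rotation group\<close>
lemma vec_eq_axis: "(\<And>k. k \<noteq> f \<Longrightarrow> v $ k = 0) \<Longrightarrow> v = v$f *\<^sub>R axis f (1::real)"
  by (auto simp: vec_eq_iff axis_def)

lemma entry_eq_axis_image: "Q $ r $ c = (Q *v axis c (1::real)) $ r"
  by (simp add: matrix_vector_mult_basis column_def)

text \<open>
  An isometry preserves the orthogonality of \<open>e\<^sub>f\<close> and \<open>e\<^sub>k\<close>. The proof uses the equivalent fact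
  that the inverse \<open>Q\<^sup>T\<close> fixes \<open>e\<^sub>k\<close> as well.
\<close>
lemma SO_fixed_axis_orthogonal:
  assumes "Q \<in> SO" "Q *v axis k 1 = axis k 1" "k \<noteq> f"
  shows "(Q *v axis f 1) $ k = 0"
proof -
  have "transpose Q *v axis k 1 = transpose Q *v (Q *v axis k 1)"
    by (simp only: assms(2))
  also have "\<dots> = axis k 1"
    by (simp only: matrix_vector_mul_assoc SO_inverse[OF assms(1)] matrix_vector_mul_lid)
  finally have "transpose Q $ f $ k = 0"
    using assms(3) unfolding entry_eq_axis_image by (simp add: axis_def)
  then show ?thesis
    by (simp add: entry_eq_axis_image[symmetric] transpose_def)
qed

text \<open>
  Such a matrix is diagonal with a single entry \<open>a\<close> in doubt, and \<open>a\<close> is the determinant. This is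
  the one place in the generation argument where \<open>det Q = 1\<close>, and not only orthogonality, matters.
\<close>
lemma SO_fixes_all_axes_but_one:
  fixes Q :: "real^'n^'n"
  assumes Q: "Q \<in> SO" and fixed: "\<And>k. k \<noteq> f \<Longrightarrow> Q *v axis k 1 = axis k 1"
  shows "Q = mat 1"
proof -
  define a where "a = (Q *v axis f 1) $ f"
  have Qf: "Q *v axis f 1 = a *\<^sub>R axis f 1"
    unfolding a_def by (rule vec_eq_axis) (use SO_fixed_axis_orthogonal[OF Q fixed] in blast)
  have diag: "Q $ r $ c = (if r = c then if c = f then a else 1 else 0)" for r c
    using Qf fixed[of c] unfolding entry_eq_axis_image by (cases "c = f") (auto simp: axis_def)
  have "det Q = (\<Prod>k\<in>UNIV. if k = f then a else 1)"
    by (subst det_diagonal) (simp_all add: diag)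
  then have "a = 1"
    using Q by (simp add: SO_def rotation_matrix_def)
  then show ?thesis
    by (simp add: vec_eq_iff diag mat_def)
qed

text \<open>
  A monoid is enough for the elimination below: it splits off a factor \<open>P\<close> of \<open>Q\<close> by passing to
  \<open>P\<^sup>T Q\<close>, which lies in \<open>H\<close> by induction, and recovers \<open>Q\<close> as \<open>P (P\<^sup>T Q)\<close>. The inverse
  \<open>P\<^sup>T\<close> itself never has to be shown to lie in \<open>H\<close>.
\<close>
locale rotation_monoid =
  fixes H :: "(real^'n^'n) set"
  assumes one: "mat 1 \<in> H"
    and mult: "P \<in> H \<Longrightarrow> Q \<in> H \<Longrightarrow> P ** Q \<in> H"
    and plane: "i \<noteq> j \<Longrightarrow> plane_rotation i j t \<in> H"
begin

text \<open>
  Givens elimination, read backwards: one plane rotation for each \<open>g \<in> S\<close> merges the entry at \<open>g\<close>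
  into the entry at \<open>f\<close>, until only a multiple \<open>c\<close> of \<open>e\<^sub>f\<close> is left. The factor \<open>c\<close> is left free so
  that the induction can start with \<open>S\<close> empty, where its sign cannot be changed.
\<close>
lemma ex_rotate_axis_onto_line:
  assumes "finite S" "f \<notin> S" "\<And>k. k \<notin> insert f S \<Longrightarrow> v $ k = 0"
  shows "\<exists>P c. P \<in> H \<and> P \<in> SO \<and> (\<forall>k. k \<notin> insert f S \<longrightarrow> P *v axis k 1 = axis k 1) \<and>
    P *v (c *\<^sub>R axis f 1) = v"
  using assms
proof (induction S arbitrary: v rule: finite_induct)
  case empty
  then have "v = v$f *\<^sub>R axis f 1"
    by (intro vec_eq_axis) auto
  then show ?case
    by (intro exI[of _ "mat 1"] exI[of _ "v$f"]) (simp add: one SO_one)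
next
  case (insert g S)
  have fg: "g \<noteq> f" using insert.prems by auto
  \<comment> \<open>Polar coordinates of the pair of entries at \<open>f\<close> and \<open>g\<close>.\<close>
  obtain r t where rt: "v$f = r * cos t" "v$g = r * sin t"
  proof (cases "(v$f)\<^sup>2 + (v$g)\<^sup>2 = 0")
    case True
    then show thesis using that[of 0 0] by simp
  next
    case False
    define r where "r = sqrt ((v$f)\<^sup>2 + (v$g)\<^sup>2)"
    have r: "r \<noteq> 0" "r\<^sup>2 = (v$f)\<^sup>2 + (v$g)\<^sup>2"
      using False by (simp_all add: r_def)
    then have "(v$f / r)\<^sup>2 + (v$g / r)\<^sup>2 = 1"
      by (simp add: power_divide add_divide_distrib[symmetric] del: sum_power2_eq_zero_iff flip: r(2))
    then obtain t where "v$f / r = cos t" "v$g / r = sin t"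
      using sincos_total_2pi by metis
    then show thesis using that[of r t] r(1) by (simp add: field_simps)
  qed
  define w :: "real^'n" where "w = (\<chi> k. if k = g then 0 else if k = f then r else v$k)"
  let ?R = "plane_rotation g f t"
  have R: "?R *v w = v"
    using fg rt by (simp add: plane_rotation_mult_vec w_def vec_eq_iff mult.commute)
  have "\<exists>P c. P \<in> H \<and> P \<in> SO \<and> (\<forall>k. k \<notin> insert f S \<longrightarrow> P *v axis k 1 = axis k 1) \<and>
      P *v (c *\<^sub>R axis f 1) = w"
    by (rule insert.IH) (use insert.prems in \<open>auto simp: w_def\<close>)
  then obtain P c where P: "P \<in> H" "P \<in> SO" "P *v (c *\<^sub>R axis f 1) = w"
    and fixed: "\<And>k. k \<notin> insert f S \<Longrightarrow> P *v axis k 1 = axis k 1"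
    by blast
  show ?case
  proof (intro exI conjI allI impI)
    show "?R ** P \<in> H" "?R ** P \<in> SO"
      using P fg by (auto intro: mult plane SO_mult plane_rotation_SO)
    show "(?R ** P) *v (c *\<^sub>R axis f 1) = v"
      by (simp only: matrix_vector_mul_assoc[symmetric] P R)
    show "(?R ** P) *v axis k 1 = axis k 1" if "k \<notin> insert f (insert g S)" for k
      using that fg fixed[of k]
      by (simp add: matrix_vector_mul_assoc[symmetric] plane_rotation_fixes_axis)
  qed
qed

text \<open>
  Here \<open>c\<close> is \<open>1\<close> or \<open>-1\<close>; the wrong sign is repaired by a half turn in a plane containing \<open>e\<^sub>f\<close>,
  for which a second coordinate in \<open>S\<close> is needed.
\<close>
lemma ex_rotate_axis_to_unit_vector:
  assumes "finite S" "f \<notin> S" "S \<noteq> {}" "\<And>k. k \<notin> insert f S \<Longrightarrow> v $ k = 0" "norm v = 1"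
  obtains P where "P \<in> H" "P \<in> SO" "\<And>k. k \<notin> insert f S \<Longrightarrow> P *v axis k 1 = axis k 1"
    "P *v axis f 1 = v"
proof -
  obtain P c where P: "P \<in> H" "P \<in> SO" "P *v (c *\<^sub>R axis f 1) = v"
    and fixed: "\<And>k. k \<notin> insert f S \<Longrightarrow> P *v axis k 1 = axis k 1"
    using ex_rotate_axis_onto_line[OF assms(1,2,4)] by blast
  have "norm (c *\<^sub>R axis f (1::real)) = 1"
    using SO_norm[OF P(2)] P(3) assms(5) by metis
  then have "c = 1 \<or> c = -1" by (auto simp: norm_axis_1)
  then show thesis
  proof
    assume "c = 1"
    then show thesis using that[of P] P fixed by simp
  next
    assume c: "c = -1"
    obtain g where g: "g \<in> S" using assms(3) by blast
    then have fg: "f \<noteq> g" using assms(2) by auto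
    let ?R = "plane_rotation f g pi"
    have R: "?R *v axis f 1 = c *\<^sub>R axis f 1"
      using fg by (simp add: plane_rotation_mult_vec c vec_eq_iff axis_def)
    show thesis
    proof (rule that[of "P ** ?R"])
      show "P ** ?R \<in> H" "P ** ?R \<in> SO"
        using P fg by (auto intro: mult plane SO_mult plane_rotation_SO)
      show "(P ** ?R) *v axis f 1 = v"
        by (simp only: matrix_vector_mul_assoc[symmetric] P R)
      show "(P ** ?R) *v axis k 1 = axis k 1" if "k \<notin> insert f S" for k
        using that fg fixed[of k] \<open>g \<in> S\<close>
        by (cases "k = g") (simp_all add: matrix_vector_mul_assoc[symmetric] plane_rotation_fixes_axis)
    qed
  qed
qed

text \<open>
  Induction on the set \<open>F\<close> of axes that \<open>Q\<close> may move. If \<open>P\<close> is a product of plane rotations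
  inside \<open>F\<close> with \<open>P e\<^sub>f = Q e\<^sub>f\<close>, then \<open>P\<^sup>T Q\<close> fixes one more axis and \<open>Q = P (P\<^sup>T Q)\<close>.
\<close>
lemma mem_if_fixes_axes:
  assumes "finite F" "Q \<in> SO" "\<And>k. k \<notin> F \<Longrightarrow> Q *v axis k 1 = axis k 1"
  shows "Q \<in> H"
  using assms
proof (induction F arbitrary: Q rule: finite_induct)
  case empty
  then show ?case
    using SO_fixes_all_axes_but_one[of Q] one by auto
next
  case (insert f F)
  show ?case
  proof (cases "F = {}")
    case True
    then show ?thesis
      using SO_fixes_all_axes_but_one[of Q f] insert.prems one by auto
  next
    case False
    have "(Q *v axis f 1) $ k = 0" if "k \<notin> insert f F" for k
      using SO_fixed_axis_orthogonal insert.prems that by (metis insertCI)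
    moreover have "norm (Q *v axis f 1) = 1"
      by (simp add: SO_norm insert.prems norm_axis_1)
    ultimately obtain P where P: "P \<in> H" "P \<in> SO" "P *v axis f 1 = Q *v axis f 1"
      and fixed: "\<And>k. k \<notin> insert f F \<Longrightarrow> P *v axis k 1 = axis k 1"
      using ex_rotate_axis_to_unit_vector[OF insert.hyps False] by metis
    have "transpose P ** Q \<in> H"
    proof (rule insert.IH)
      show "transpose P ** Q \<in> SO"
        by (intro SO_mult SO_transpose P insert.prems)
      fix k assume "k \<notin> F"
      then have "Q *v axis k 1 = P *v axis k 1"
        using P(3) fixed[of k] insert.prems(2)[of k] by (cases "k = f") auto
      then have "(transpose P ** Q) *v axis k 1 = (transpose P ** P) *v axis k 1"
        by (simp only: matrix_vector_mul_assoc[symmetric])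
      then show "(transpose P ** Q) *v axis k 1 = axis k 1"
        by (simp only: SO_inverse[OF P(2)] matrix_vector_mul_lid)
    qed
    then have "P ** (transpose P ** Q) \<in> H"
      by (rule mult[OF P(1)])
    then show ?thesis
      by (simp add: matrix_mul_assoc SO_inverse[OF P(2)])
  qed
qed

lemma SO_subset: "SO \<subseteq> H"
  using mem_if_fixes_axes[of UNIV] by auto

end

section \<open>Reachable sets\<close>
lemma reach_skew_flow:
  assumes skew: "A \<in> so" "\<And>k. k \<in> {1..m} \<Longrightarrow> B k \<in> so"
    and "Y \<in> reach A m B X0"
  obtains T S u X W where "0 \<le> T" "X 0 = X0" "X T = Y" "continuous_on {0..T} X" "finite S"
    "W = (\<lambda>t. A + (\<Sum>k = 1..m. u k t *\<^sub>R B k))"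
    "\<And>t. t \<in> {0..T} - S \<Longrightarrow> (X has_vector_derivative (W t ** X t)) (at t within {0..T})"
    "\<And>t. transpose (W t) = - W t"
proof -
  obtain T X u where T: "0 \<le> T" and sol: "bilinear_solution A m B u T X"
    and X: "X 0 = X0" "X T = Y"
    using assms(3) by (auto simp: reach_def reach_at_def)
  define W where "W = (\<lambda>t. A + (\<Sum>k = 1..m. u k t *\<^sub>R B k))"
  have W: "A ** X t + (\<Sum>k = 1..m. u k t *\<^sub>R B k) ** X t = W t ** X t" for t
    by (simp add: W_def matrix_mult_linear_simps)
  obtain S where "finite S" "\<And>t. t \<in> {0..T} - S \<Longrightarrow>
      (X has_vector_derivative (W t ** X t)) (at t within {0..T})" "continuous_on {0..T} X"
    using sol unfolding bilinear_solution_def W by blast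
  moreover have "transpose (W t) = - W t" for t
    using skew by (simp add: W_def so_def transpose_linear_simps sum_negf)
  ultimately show thesis
    using that T X W_def by blast
qed

lemma reach_subset_SO:
  assumes "A \<in> so" "\<And>k. k \<in> {1..m} \<Longrightarrow> B k \<in> so"
  shows "reach A m B (mat 1) \<subseteq> SO"
proof
  fix Y assume "Y \<in> reach A m B (mat 1)"
  with assms show "Y \<in> SO"
  proof (rule reach_skew_flow)
    fix T S u X W
    assume T: "0 \<le> T" and X: "X 0 = mat 1" "X T = Y"
      and flow: "continuous_on {0..T} X" "finite S"
        "\<And>t. t \<in> {0..T} - S \<Longrightarrow> (X has_vector_derivative (W t ** X t)) (at t within {0..T})"
        "\<And>t. transpose (W t) = - W t"
    show "Y \<in> SO"
      using skew_flow_SO[OF flow X(1) T] by (simp add: X(2))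
  qed
qed

lemma reach_conserves:
  assumes skew: "A \<in> so" "\<And>k. k \<in> {1..m} \<Longrightarrow> B k \<in> so"
    and comm: "M ** A = A ** M" "\<And>k. k \<in> {1..m} \<Longrightarrow> M ** B k = B k ** M"
    and Y: "Y \<in> reach A m B (mat 1)"
  shows "transpose Y ** M ** Y = M"
  using skew Y
proof (rule reach_skew_flow)
  fix T S u X W
  assume T: "0 \<le> T" and X: "X 0 = mat 1" "X T = Y"
    and flow: "continuous_on {0..T} X" "finite S"
      "\<And>t. t \<in> {0..T} - S \<Longrightarrow> (X has_vector_derivative (W t ** X t)) (at t within {0..T})"
      "\<And>t. transpose (W t) = - W t"
    and W: "W = (\<lambda>t. A + (\<Sum>k = 1..m. u k t *\<^sub>R B k))"
  have "M ** W t = W t ** M" for t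
    by (simp add: W matrix_mult_linear_simps comm)
  then have "transpose (X T) ** M ** X T = transpose (X 0) ** M ** X 0"
    using T by (intro skew_flow_conserves[OF flow]) auto
  then show ?thesis by (simp add: X)
qed

lemma start_mem_reach: "X0 \<in> reach A m B X0"
proof -
  have "bilinear_solution A m B (\<lambda>_ _. 0) 0 (\<lambda>_. X0)"
    unfolding bilinear_solution_def by (auto intro: exI[of _ "{0}"])
  moreover have "piecewise_constant (\<lambda>_. 0)"
    unfolding piecewise_constant_def constant_on_def by (auto intro: exI[of _ "{}"])
  ultimately show ?thesis
    unfolding reach_def reach_at_def by (auto intro!: bexI[of _ 0])
qed

lemma piecewise_constant_extend:
  assumes "piecewise_constant u"
  shows "piecewise_constant (\<lambda>t. if t \<le> T then u t else c)"
proof -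
  obtain S where S: "\<And>T. finite (S \<inter> {0..T})"
    "\<And>a b. 0 \<le> a \<Longrightarrow> {a..b} \<inter> S = {} \<Longrightarrow> u constant_on {a..b}"
    using assms unfolding piecewise_constant_def by blast
  show ?thesis
    unfolding piecewise_constant_def
  proof (intro exI[of _ "insert T S"] conjI allI impI)
    show "finite (insert T S \<inter> {0..T'})" for T'
      by (simp add: S(1) Int_insert_left)
    fix a b :: real assume ab: "0 \<le> a \<and> {a..b} \<inter> insert T S = {}"
    then have "u constant_on {a..b}" "T \<notin> {a..b}"
      using S(2) by auto
    then show "(\<lambda>t. if t \<le> T then u t else c) constant_on {a..b}"
      by (cases "T < a") (auto simp: constant_on_def)
  qed
qed

text \<open>
  Appending one unit of time in which only control \<open>k\<close> is active, with value \<open>s\<close>, multiplies the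
  terminal point from the left by \<open>exp (s B\<^sub>k)\<close>. Without a
  drift term nothing else moves during that time.
\<close>
lemma reach_step:
  assumes k: "k \<in> {1..m}" and cube: "B k ** B k ** B k = - B k" and "Y \<in> reach 0 m B X0"
  shows "rodrigues (B k) s ** Y \<in> reach 0 m B X0"
proof -
  obtain T X u where T: "0 \<le> T" and sol: "bilinear_solution 0 m B u T X"
    and pc: "\<And>k. k \<in> {1..m} \<Longrightarrow> piecewise_constant (u k)"
    and X: "X 0 = X0" "Y = X T"
    using assms(3) by (auto simp: reach_def reach_at_def)
  obtain S where S: "finite S" and deriv: "\<And>t. t \<in> {0..T} - S \<Longrightarrow>
      (X has_vector_derivative ((\<Sum>k = 1..m. u k t *\<^sub>R B k) ** X t)) (at t within {0..T})"
    and cont: "continuous_on {0..T} X"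
    using sol unfolding bilinear_solution_def by (auto simp: matrix_mult_linear_simps)
  define R where "R = (\<lambda>t. rodrigues (B k) ((t - T) * s) ** Y)"
  define Z where "Z = (\<lambda>t. if t \<le> T then X t else R t)"
  define v where "v = (\<lambda>l t. if t \<le> T then u l t else if l = k then s else 0)"
  have dR: "(R has_vector_derivative (s *\<^sub>R B k) ** R t) (at t within A)" for t A
    unfolding R_def
    using bounded_linear.has_vector_derivative[OF bounded_bilinear.bounded_linear_left[OF
          bounded_bilinear_matrix_mult] rodrigues_derivative[where a = T and s = s, OF cube]]
    by (simp add: matrix_mul_assoc)
  have "continuous_on ({0..T} \<union> {T..T+1}) Z"
    unfolding Z_def
  proof (rule continuous_on_cases)
    show "continuous_on {T..T+1} R"
      by (rule continuous_on_vector_derivative) (rule dR)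
  qed (use cont in \<open>auto simp: R_def rodrigues_0 X\<close>)
  then have contZ: "continuous_on {0..T+1} Z"
    using T by (simp add: ivl_disj_un_two_touch)
  have dZ: "(Z has_vector_derivative (\<Sum>l = 1..m. v l t *\<^sub>R B l) ** Z t) (at t within {0..T+1})"
    if t: "t \<in> {0..T+1} - insert T S" for t
  proof (cases "t < T")
    case True
    then have "(X has_vector_derivative (\<Sum>l = 1..m. v l t *\<^sub>R B l) ** Z t) (at t within {0..T})"
      using deriv[of t] t by (simp add: v_def Z_def)
    then have "(Z has_vector_derivative (\<Sum>l = 1..m. v l t *\<^sub>R B l) ** Z t) (at t within {0..T})"
      by (rule has_vector_derivative_transform[rotated 2]) (use t True in \<open>auto simp: Z_def\<close>)
    moreover have "at t within {0..T} = at t within {0..T+1}"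
      by (rule at_within_nhd[of t "{..<T}"]) (use True in auto)
    ultimately show ?thesis by simp
  next
    case False
    then have "T < t" using t by auto
    then have "(\<Sum>l = 1..m. v l t *\<^sub>R B l) = (\<Sum>l = 1..m. if l = k then s *\<^sub>R B k else 0)"
      by (intro sum.cong) (auto simp: v_def)
    then have "(R has_vector_derivative (\<Sum>l = 1..m. v l t *\<^sub>R B l) ** Z t) (at t within {T<..T+1})"
      using dR[of t] k \<open>T < t\<close> by (simp add: Z_def)
    then have "(Z has_vector_derivative (\<Sum>l = 1..m. v l t *\<^sub>R B l) ** Z t) (at t within {T<..T+1})"
      by (rule has_vector_derivative_transform[rotated 2]) (use t \<open>T < t\<close> in \<open>auto simp: Z_def\<close>)
    moreover have "at t within {T<..T+1} = at t within {0..T+1}"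
      by (rule at_within_nhd[of t "{T<..}"]) (use \<open>T < t\<close> T in auto)
    ultimately show ?thesis by simp
  qed
  have "bilinear_solution 0 m B v (T+1) Z"
    unfolding bilinear_solution_def
  proof (intro conjI exI[of _ "insert T S"] ballI)
    fix t assume "t \<in> {0..T+1} - insert T S"
    from dZ[OF this]
    show "(Z has_vector_derivative 0 ** Z t + (\<Sum>l = 1..m. v l t *\<^sub>R B l) ** Z t)
        (at t within {0..T+1})"
      by (simp add: bounded_bilinear.zero_left[OF bounded_bilinear_matrix_mult])
  qed (use contZ S in auto)
  moreover have "piecewise_constant (v l)" if "l \<in> {1..m}" for l
    using piecewise_constant_extend[OF pc[OF that], of T "if l = k then s else 0"]
    by (simp add: v_def)
  moreover have "Z 0 = X0" "Z (T+1) = rodrigues (B k) s ** Y"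
    using T X by (auto simp: Z_def R_def)
  ultimately have "rodrigues (B k) s ** Y \<in> reach_at 0 m B X0 (T+1)"
    unfolding reach_at_def by (auto intro!: exI[of _ Z] exI[of _ v])
  then show ?thesis
    using T unfolding reach_def by (auto intro!: bexI[of _ "T+1"])
qed

section \<open>Connectedness and controllability\<close>
lemma graph_path_reflp_transp:
  assumes "graph_path V E x p y" and edge: "\<And>v w. {v, w} \<in> E \<Longrightarrow> R v w"
    and "reflp R" "transp R"
  shows "R x y"
proof -
  have "R (hd p) (last p)" if "p \<noteq> []" "successively (\<lambda>v w. {v, w} \<in> E) p" for p
    using that
  proof (induction p)
    case (Cons a p)
    then show ?case
      using edge[of a "hd p"] assms(3,4)
      by (cases p) (auto dest: transpD reflpD)
  qed simp
  then show ?thesis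
    using assms(1) unfolding graph_path_def by auto
qed

text \<open>
  Paths have distinct nodes, so if \<open>w\<close> already lies on the path, the path is cut off at \<open>w\<close> instead
  of being prolonged.
\<close>
lemma graph_path_extend:
  assumes p: "graph_path UNIV E x p v" and e: "{v, w} \<in> E"
  shows "\<exists>q. graph_path UNIV E x q w"
proof (cases "w \<in> set p")
  case True
  then obtain ys zs where "p = ys @ w # zs"
    by (meson split_list)
  then have "graph_path UNIV E x (ys @ [w]) w"
    using p successively_append_iff[of _ "ys @ [w]" zs]
    unfolding graph_path_def by (cases ys) auto
  then show ?thesis ..
next
  case False
  then have "graph_path UNIV E x (p @ [w]) w"
    using p e unfolding graph_path_def by (auto simp: successively_append_iff)
  then show ?thesis ..
qed

text \<open>
  The argument runs in the monoid \<open>H\<close> of matrices that map the reachable set into itself, because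
  left multiplication by single rotations is what \<open>reach_step\<close> provides. Every edge of the graph
  contributes its rotations to \<open>H\<close>, and conjugation by quarter turns propagates them along paths.
\<close>
lemma SO_subset_reach_if_connected:
  fixes i j :: "nat \<Rightarrow> 'n::finite"
  assumes conn: "graph_connected UNIV (controlled_edges m i j)"
    and ij: "\<And>k. k \<in> {1..m} \<Longrightarrow> i k \<noteq> j k"
  shows "SO \<subseteq> reach 0 m (\<lambda>k. Bmat (i k) (j k)) (mat 1)"
proof -
  let ?G = "reach 0 m (\<lambda>k. Bmat (i k) (j k)) (mat 1)"
  define H where "H = {Q. \<forall>Y\<in>?G. Q ** Y \<in> ?G}"
  define R where "R = (\<lambda>v w. v \<noteq> w \<longrightarrow> (\<forall>t. plane_rotation v w t \<in> H))"
  have mult: "P ** Q \<in> H" if "P \<in> H" "Q \<in> H" for P Q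
    using that by (auto simp: H_def matrix_mul_assoc[symmetric])
  have edge: "R v w" if "{v, w} \<in> controlled_edges m i j" for v w
  proof -
    obtain k where k: "k \<in> {1..m}" "{v, w} = {i k, j k}"
      using \<open>{v, w} \<in> controlled_edges m i j\<close> unfolding controlled_edges_def by blast
    have "plane_rotation (i k) (j k) t \<in> H" for t
      using reach_step[OF k(1), of "\<lambda>k. Bmat (i k) (j k)"] Bmat_cube[OF ij[OF k(1)]]
      by (simp add: H_def plane_rotation_def)
    then show ?thesis
      using k(2) plane_rotation_swap[of v w] by (auto simp: R_def doubleton_eq_iff)
  qed
  have "transp R"
  proof (rule transpI)
    fix a b c assume "R a b" "R b c"
    then show "R a c"
      using plane_rotation_conjugate[of a b c] mult
      unfolding R_def by metis
  qed
  moreover have "reflp R"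
    by (rule reflpI) (simp add: R_def)
  ultimately have R: "R v w" if "v \<noteq> w" for v w
    using conn that graph_path_reflp_transp[where R = R and E = "controlled_edges m i j"] edge
    unfolding graph_connected_def by (meson UNIV_I)
  interpret rotation_monoid H
    by unfold_locales (use mult R in \<open>auto simp: R_def H_def\<close>)
  show ?thesis
  proof
    fix Q :: "real^'n^'n" assume "Q \<in> SO"
    then have "Q ** mat 1 \<in> ?G"
      using SO_subset start_mem_reach unfolding H_def by blast
    then show "Q \<in> ?G" by simp
  qed
qed


definition coordinate_projection :: "'n set \<Rightarrow> real^'n^'n" where
  "coordinate_projection C = (\<chi> r c. if r = c \<and> c \<in> C then 1 else 0)"

lemma coordinate_projection_mult_vec:
  "coordinate_projection C *v (x::real^'n) = (\<chi> k. if k \<in> C then x$k else 0)"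
proof -
  have "(\<Sum>c\<in>UNIV. (if r = c \<and> c \<in> C then 1 else 0) * x$c) = (\<Sum>c\<in>UNIV. if r = c then if r \<in> C then x$r else 0 else 0)" for r
    by (rule sum.cong) auto
  then show ?thesis
    by (simp add: coordinate_projection_def matrix_vector_mult_def)
qed

text \<open>
  \<open>B\<^sub>i\<^sub>j\<close> exchanges \<open>e\<^sub>i\<close> and \<open>e\<^sub>j\<close> up to sign and annihilates the other axes, so it preserves the
  span of the axes in \<open>C\<close> and its complement unless \<open>C\<close> separates \<open>i\<close> from \<open>j\<close>.
\<close>
lemma coordinate_projection_commutes_Bmat:
  assumes "i \<in> C \<longleftrightarrow> j \<in> C"
  shows "coordinate_projection C ** Bmat i j = Bmat i j ** coordinate_projection C"
  unfolding matrix_eq matrix_vector_mul_assoc[symmetric] coordinate_projection_mult_vec Bmat_mult_vec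
  using assms by (auto simp: vec_eq_iff axis_def)

text \<open>
  If no path joins \<open>x\<close> to \<open>y\<close>, let \<open>C\<close> be the component of \<open>x\<close>. The projection onto \<open>C\<close> commutes
  with every control matrix, hence with every reachable matrix. The quarter turn taking \<open>e\<^sub>x\<close> to
  \<open>-e\<^sub>y\<close> violates this, so it is a rotation that cannot be reached.
\<close>
lemma connected_if_SO_subset_reach:
  fixes i j :: "nat \<Rightarrow> 'n::finite"
  assumes sub: "SO \<subseteq> reach 0 m (\<lambda>k. Bmat (i k) (j k)) (mat 1)"
  shows "graph_connected UNIV (controlled_edges m i j)"
proof (rule ccontr)
  let ?E = "controlled_edges m i j"
  assume "\<not> graph_connected UNIV ?E"
  then obtain x y where xy: "x \<noteq> y" "\<nexists>p. graph_path UNIV ?E x p y"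
    unfolding graph_connected_def by blast
  define C where "C = {z. \<exists>p. graph_path UNIV ?E x p z}"
  have "graph_path UNIV ?E x [x] x"
    by (simp add: graph_path_def)
  then have x: "x \<in> C" and y: "y \<notin> C"
    using xy(2) unfolding C_def by blast+
  have C: "i k \<in> C \<longleftrightarrow> j k \<in> C" if "k \<in> {1..m}" for k
  proof -
    have "{i k, j k} \<in> ?E" "{j k, i k} \<in> ?E"
      using that by (auto simp: controlled_edges_def)
    then show ?thesis
      unfolding C_def using graph_path_extend by fast
  qed
  let ?M = "coordinate_projection C" and ?Q = "plane_rotation x y (pi/2)"
  have "transpose ?Q ** ?M ** ?Q = ?M"
  proof (rule reach_conserves)
    show "?Q \<in> reach 0 m (\<lambda>k. Bmat (i k) (j k)) (mat 1)"
      using sub plane_rotation_SO[OF xy(1)] by blast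
  qed (auto simp: so_def transpose_linear_simps transpose_Bmat matrix_mult_linear_simps C
      coordinate_projection_commutes_Bmat)
  then have "transpose ?Q *v (?M *v (?Q *v axis x 1)) = ?M *v axis x 1"
    by (simp only: matrix_vector_mul_assoc matrix_mul_assoc)
  moreover have "?M *v (?Q *v axis x 1) = 0"
    unfolding plane_rotation_mult_vec[OF xy(1)] coordinate_projection_mult_vec
    using y by (auto simp: vec_eq_iff axis_def)
  moreover have "(?M *v axis x 1) $ x = 1"
    using x by (simp add: coordinate_projection_mult_vec)
  ultimately show False by simp
qed

theorem proposition1:
  fixes A :: "real^'n::{finite,linorder}^'n::{finite,linorder}"
    and m :: nat
    and i j :: "nat \<Rightarrow> 'n"
  assumes "A \<in> so"
    and "\<And>k. k \<in> {1..m} \<Longrightarrow> i k < j k"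
    and "A = 0"
  shows "controllable_on_SO A m (\<lambda>k. Bmat (i k) (j k)) \<longleftrightarrow>
         graph_connected (UNIV :: 'n set) (controlled_edges m i j)"
proof -
  have "reach A m (\<lambda>k. Bmat (i k) (j k)) (mat 1) \<subseteq> SO"
    by (rule reach_subset_SO[OF assms(1)]) (simp add: so_def transpose_Bmat)
  then show ?thesis
    using SO_subset_reach_if_connected[of m i j] connected_if_SO_subset_reach[of m i j] assms(2)
    unfolding controllable_on_SO_def \<open>A = 0\<close> by (metis order_less_irrefl subset_antisym subset_refl)
qed

end
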